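(* Let $\gamma>0$, $\beta\ge0$, $p\in[0,1]$ be constants. Let $\overline U$ be a supersolution and $\underline U$ a subsolution of the Lax-Friedrichs scheme $$\widehat{\overline{\underline H}}_{\mathrm{LF}}[U_\alpha]=0\ \text{ if }\mathbf x_\alpha\in\mathcal T_{\mathbf h}\cap\Omega,\qquad U_\alpha-g(\mathbf x_\alpha)=0\ \text{ if }\mathbf x_\alpha\in\mathcal T_{\mathbf h}\cap\partial\Omega,$$ with $\underline U\le\overline U$, and with $\gamma>0$ sufficiently large to ensure that $\widehat{\overline{\underline H}}_{\mathrm{LF}}$ is monotone over $\overline{\underline S}(\mathcal T_{\mathbf h})=\{V:\underline U_\alpha\le V_\alpha\le\overline U_\alpha\ \text{for all }\mathbf x_\alpha\in\mathcal T_{\mathbf h}\}$. Then the modified high-order corrector scheme $$\widehat{\overline{\underline H}}_{\mathbf h}[U_\alpha]=0\ \text{ if }\mathbf x_\alpha\in\mathcal T_{\mathbf h}\cap\Omega,\qquad U_\alpha-g(\mathbf x_\alpha)=0\ \text{ if }\mathbf x_\alpha\in\mathcal T_{\mathbf h}\cap\partial\Omega,\qquad B_{\mathbf h}U_\alpha=0\ \text{ if }\mathbf x_\alpha\in\mathcal S_{h_i},$$ with the cutoffs in $\widehat{\overline{\underline H}}_{\mathbf h}$ defined by $\underline U$ and $\overline U$, has a solution in $\overline{\underline S}(\mathcal T_{\mathbf h})$.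
   Context: Setting: $\Omega=(a_1,b_1)\times\cdots\times(a_d,b_d)$; $\theta>0$ is constant; $g$ is continuous on $\partial\Omega$; $H:\mathbb R^d\times\mathbb R\times\overline\Omega\to\mathbb R$, $(\mathbf q,u,\mathbf x)\mapsto H(\mathbf q,u,\mathbf x)$, is locally Lipschitz and nondecreasing in $u$. (The scheme approximates $H(\nabla u,u,\mathbf x)+\theta u=0$ in $\Omega$, $u=g$ on $\partial\Omega$.) Grid: for integers $J_i\ge 2$ let $h_i=(b_i-a_i)/(J_i-1)$, $\mathbf h=(h_1,\dots,h_d)$, $h=\max_i h_i$. For $\alpha$ with $1\le\alpha_i\le J_i$, $\mathbf x_\alpha=(a_1+(\alpha_1-1)h_1,\dots,a_d+(\alpha_d-1)h_d)$; $\mathcal T_{\mathbf h}$ is the set of all $\mathbf x_\alpha$. Grid functions are maps $\mathcal T_{\mathbf h}\to\mathbb R$, with nodewise inequalities. $\mathbf e_i$ are the canonical basis vectors. $\mathcal S_{h_i}=\{\mathbf x_\alpha\in\mathcal T_{\mathbf h}\cap\partial\Omega:\ \mathbf x_\alpha+h_i\mathbf e_i\in\mathcal T_{\mathbf h}\cap\Omega\text{ or }\mathbf x_\alpha-h_i\mathbf e_i\in\mathcal T_{\mathbf h}\cap\Omega\}$. Difference operators: $\nabla_{\mathbf h}V_\alpha=\big[\frac{V_{\alpha+\mathbf e_i}-V_{\alpha-\mathbf e_i}}{2h_i}\big]_{i=1}^d$, $\delta^2_{x_i,h_i}V_\alpha=\frac{V_{\alpha+\mathbf e_i}-2V_\alpha+V_{\alpha-\mathbf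 e_i}}{h_i^2}$, $\Delta_{\mathbf h}=\sum_{i=1}^d\delta^2_{x_i,h_i}$. Operators: $H_{\mathbf h}[V_\alpha]=-\beta h^2\Delta_{\mathbf h}V_\alpha+H(\nabla_{\mathbf h}V_\alpha,V_\alpha,\mathbf x_\alpha)+\theta V_\alpha$; $\widehat{\overline{\underline H}}_{\mathrm{LF}}=H_{\mathbf h}-\frac{\gamma}{2}h^p\Delta_{\mathbf h}$; with $L_i^\pm V_\alpha=2V_{\alpha\pm\mathbf e_i}-V_{\alpha\pm2\mathbf e_i}$, the truncated operators are $$\overline{\underline L}_i^\pm V_\alpha=\begin{cases}\overline U_\alpha&\text{if }L_i^\pm V_\alpha>\overline U_\alpha,\\ \underline U_\alpha&\text{if }L_i^\pm V_\alpha<\underline U_\alpha,\\ L_i^\pm V_\alpha&\text{otherwise,}\end{cases}$$ and $$\widehat{\overline{\underline H}}_{\mathbf h}[V_\alpha]=\widehat{\overline{\underline H}}_{\mathrm{LF}}[V_\alpha]+\frac{\gamma h^p}{2}\sum_{i=1}^d\frac1{h_i^2}V_\alpha-\frac{\gamma h^p}{4}\sum_{i=1}^d\frac1{h_i^2}\big(\overline{\underline L}_i^+V_\alpha+\overline{\underline L}_i^-V_\alpha\big).$$ Auxiliary boundary condition: at $\mathbf x_\alpha\in\mathcal S_{h_i}$, $B_{\mathbf h}$ is either $B_{\mathbf h}U_\alpha=-\delta^2_{x_i,h_i}U_\alpha$ or $B_{\mathbf h}U_\alpha=-\delta^2_{x_i,h_i}U_\alpha+\delta^2_{x_i,h_i}U_{\alpha'}$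 with $\mathbf x_{\alpha'}\in\{\mathbf x_\alpha\pm h_i\mathbf e_i\}$ the neighbor in $\mathcal T_{\mathbf h}\cap\Omega$ (the result concerns either choice). The condition $B_{\mathbf h}U_\alpha=0$ determines the ghost values $U_{\alpha\pm2\mathbf e_i}$ (outside $\overline\Omega$) needed at interior nodes adjacent to $\partial\Omega$; membership in $\overline{\underline S}(\mathcal T_{\mathbf h})$ constrains only values on $\mathcal T_{\mathbf h}$. Supersolution of the Lax-Friedrichs scheme: $\widehat{\overline{\underline H}}_{\mathrm{LF}}[\overline U_\alpha]\ge0$ on $\mathcal T_{\mathbf h}\cap\Omega$ and $\overline U_\alpha\ge g(\mathbf x_\alpha)$ on $\mathcal T_{\mathbf h}\cap\partial\Omega$; subsolution: the same with reversed inequalities. Monotone over $\overline{\underline S}(\mathcal T_{\mathbf h})$: for each $\mathbf x_\alpha\in\mathcal T_{\mathbf h}\cap\Omega$ and as long as $V$ ranges over $\overline{\underline S}(\mathcal T_{\mathbf h})$, $\widehat{\overline{\underline H}}_{\mathrm{LF}}[V_\alpha]$ is nondecreasing with respect to $V_\alpha$ and nonincreasing with respect to each $V_{\alpha\pm\mathbf e_i}$. *)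

theory Defs
  imports "HOL-Analysis.Analysis"
begin

definition locally_lipschitz_on :: "'a::metric_space set \<Rightarrow> ('a \<Rightarrow> 'b::metric_space) \<Rightarrow> bool" where
  "locally_lipschitz_on X f \<longleftrightarrow> (\<forall>x\<in>X. \<exists>r>0. \<exists>L. L-lipschitz_on (ball x r \<inter> X) f)"

text \<open>Multi-indices range over all of \<open>\<int>\<^sup>d\<close>: the nodes of the grid are those with
  \<open>1 \<le> \<alpha>\<^sub>i \<le> J\<^sub>i\<close>, and ghost values are the values of a function on \<open>\<int>\<^sup>d\<close> at indices outside this
  range. The vector of mesh widths is \<open>h\<close> throughout, with \<open>mesh_size h\<close> its largest entry.\<close>

type_synonym 'n grid_fun = "int ^ 'n \<Rightarrow> real"

definition mesh_widths :: "real ^ 'n \<Rightarrow> real ^ 'n \<Rightarrow> nat ^ 'n \<Rightarrow> real ^ 'n" where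
  "mesh_widths a b J = (\<chi> i. (b $ i - a $ i) / (real (J $ i) - 1))"

definition mesh_size :: "real ^ 'n \<Rightarrow> real" where
  "mesh_size h = Max (range (\<lambda>i. h $ i))"

definition node :: "real ^ 'n \<Rightarrow> real ^ 'n \<Rightarrow> int ^ 'n \<Rightarrow> real ^ 'n" where
  "node a h \<alpha> = (\<chi> i. a $ i + (real_of_int (\<alpha> $ i) - 1) * h $ i)"

definition grid :: "real ^ 'n \<Rightarrow> real ^ 'n \<Rightarrow> nat ^ 'n \<Rightarrow> (real ^ 'n) set" where
  "grid a h J = node a h ` {\<alpha>. \<forall>i. 1 \<le> \<alpha> $ i \<and> \<alpha> $ i \<le> int (J $ i)}"

definition interior_nodes where
  "interior_nodes a b J = grid a (mesh_widths a b J) J \<inter> box a b"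

definition boundary_nodes where
  "boundary_nodes a b J = grid a (mesh_widths a b J) J \<inter> frontier (box a b)"

definition aux_nodes :: "real ^ 'n \<Rightarrow> real ^ 'n \<Rightarrow> nat ^ 'n \<Rightarrow> 'n \<Rightarrow> (real ^ 'n) set" where
  "aux_nodes a b J i = (let h = mesh_widths a b J in
     {x \<in> boundary_nodes a b J.
        x + axis i (h $ i) \<in> interior_nodes a b J \<or> x - axis i (h $ i) \<in> interior_nodes a b J})"

definition grad_h :: "real ^ 'n \<Rightarrow> 'n grid_fun \<Rightarrow> int ^ 'n \<Rightarrow> real ^ 'n" where
  "grad_h h V \<alpha> = (\<chi> i. (V (\<alpha> + axis i 1) - V (\<alpha> - axis i 1)) / (2 * h $ i))"

definition second_diff :: "real ^ 'n \<Rightarrow> 'n \<Rightarrow> 'n grid_fun \<Rightarrow> int ^ 'n \<Rightarrow> real" where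
  "second_diff h i V \<alpha> = (V (\<alpha> + axis i 1) - 2 * V \<alpha> + V (\<alpha> - axis i 1)) / (h $ i)\<^sup>2"

definition laplace_h :: "real ^ 'n \<Rightarrow> 'n grid_fun \<Rightarrow> int ^ 'n \<Rightarrow> real" where
  "laplace_h h V \<alpha> = (\<Sum>i\<in>UNIV. second_diff h i V \<alpha>)"

definition H_h ::
  "(real ^ 'n \<Rightarrow> real \<Rightarrow> real ^ 'n \<Rightarrow> real) \<Rightarrow> real \<Rightarrow> real \<Rightarrow> real ^ 'n \<Rightarrow> real ^ 'n
    \<Rightarrow> 'n grid_fun \<Rightarrow> int ^ 'n \<Rightarrow> real" where
  "H_h H \<theta> \<beta> a h V \<alpha> =
     - \<beta> * (mesh_size h)\<^sup>2 * laplace_h h V \<alpha> + H (grad_h h V \<alpha>) (V \<alpha>) (node a h \<alpha>) + \<theta> * V \<alpha>"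

definition H_LF ::
  "(real ^ 'n \<Rightarrow> real \<Rightarrow> real ^ 'n \<Rightarrow> real) \<Rightarrow> real \<Rightarrow> real \<Rightarrow> real \<Rightarrow> real \<Rightarrow> real ^ 'n \<Rightarrow> real ^ 'n
    \<Rightarrow> 'n grid_fun \<Rightarrow> int ^ 'n \<Rightarrow> real" where
  "H_LF H \<theta> \<beta> \<gamma> p a h V \<alpha> =
     H_h H \<theta> \<beta> a h V \<alpha> - \<gamma> / 2 * mesh_size h powr p * laplace_h h V \<alpha>"

definition cutoff :: "real \<Rightarrow> real \<Rightarrow> real \<Rightarrow> real" where
  "cutoff lo hi v = (if v > hi then hi else if v < lo then lo else v)"

definition L_plus :: "'n \<Rightarrow> 'n grid_fun \<Rightarrow> int ^ 'n \<Rightarrow> real" where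
  "L_plus i V \<alpha> = 2 * V (\<alpha> + axis i 1) - V (\<alpha> + axis i 2)"

definition L_minus :: "'n \<Rightarrow> 'n grid_fun \<Rightarrow> int ^ 'n \<Rightarrow> real" where
  "L_minus i V \<alpha> = 2 * V (\<alpha> - axis i 1) - V (\<alpha> - axis i 2)"

definition H_corr ::
  "(real ^ 'n \<Rightarrow> real \<Rightarrow> real ^ 'n \<Rightarrow> real) \<Rightarrow> real \<Rightarrow> real \<Rightarrow> real \<Rightarrow> real \<Rightarrow> real ^ 'n \<Rightarrow> real ^ 'n
    \<Rightarrow> 'n grid_fun \<Rightarrow> 'n grid_fun \<Rightarrow> 'n grid_fun \<Rightarrow> int ^ 'n \<Rightarrow> real" where
  "H_corr H \<theta> \<beta> \<gamma> p a h Ulo Uhi V \<alpha> =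
     H_LF H \<theta> \<beta> \<gamma> p a h V \<alpha>
     + \<gamma> * mesh_size h powr p / 2 * (\<Sum>i\<in>UNIV. 1 / (h $ i)\<^sup>2 * V \<alpha>)
     - \<gamma> * mesh_size h powr p / 4 * (\<Sum>i\<in>UNIV. 1 / (h $ i)\<^sup>2 *
         (cutoff (Ulo \<alpha>) (Uhi \<alpha>) (L_plus i V \<alpha>) + cutoff (Ulo \<alpha>) (Uhi \<alpha>) (L_minus i V \<alpha>)))"

datatype aux_kind = Zero_Second_Diff | Matching_Second_Diff

text \<open>\<open>aux_op\<close> is used only at nodes of \<open>aux_nodes a b J i\<close>, where exactly one of the two
  neighbours in direction \<open>i\<close> is an interior node; \<open>inner_neighbour\<close> selects it.\<close>

definition inner_neighbour ::
  "real ^ 'n \<Rightarrow> real ^ 'n \<Rightarrow> nat ^ 'n \<Rightarrow> 'n \<Rightarrow> int ^ 'n \<Rightarrow> int ^ 'n" where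
  "inner_neighbour a b J i \<alpha> =
     (if node a (mesh_widths a b J) (\<alpha> + axis i 1) \<in> interior_nodes a b J
      then \<alpha> + axis i 1 else \<alpha> - axis i 1)"

definition aux_op ::
  "aux_kind \<Rightarrow> real ^ 'n \<Rightarrow> real ^ 'n \<Rightarrow> nat ^ 'n \<Rightarrow> 'n \<Rightarrow> 'n grid_fun \<Rightarrow> int ^ 'n \<Rightarrow> real" where
  "aux_op k a b J i U \<alpha> = (let h = mesh_widths a b J in
     case k of
       Zero_Second_Diff \<Rightarrow> - second_diff h i U \<alpha>
     | Matching_Second_Diff \<Rightarrow>
         - second_diff h i U \<alpha> + second_diff h i U (inner_neighbour a b J i \<alpha>))"

text \<open>Values at indices outside the grid are unconstrained here.\<close>

definition grid_between ::
  "real ^ 'n \<Rightarrow> real ^ 'n \<Rightarrow> nat ^ 'n \<Rightarrow> 'n grid_fun \<Rightarrow> 'n grid_fun \<Rightarrow> 'n grid_fun set" where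
  "grid_between a b J Ulo Uhi = (let h = mesh_widths a b J in
     {V. \<forall>\<alpha>. node a h \<alpha> \<in> grid a h J \<longrightarrow> Ulo \<alpha> \<le> V \<alpha> \<and> V \<alpha> \<le> Uhi \<alpha>})"

definition LF_supersolution where
  "LF_supersolution H \<theta> \<beta> \<gamma> p g a b J U \<longleftrightarrow> (let h = mesh_widths a b J in
     (\<forall>\<alpha>. node a h \<alpha> \<in> interior_nodes a b J \<longrightarrow> H_LF H \<theta> \<beta> \<gamma> p a h U \<alpha> \<ge> 0) \<and>
     (\<forall>\<alpha>. node a h \<alpha> \<in> boundary_nodes a b J \<longrightarrow> U \<alpha> \<ge> g (node a h \<alpha>)))"

definition LF_subsolution where
  "LF_subsolution H \<theta> \<beta> \<gamma> p g a b J U \<longleftrightarrow> (let h = mesh_widths a b J in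
     (\<forall>\<alpha>. node a h \<alpha> \<in> interior_nodes a b J \<longrightarrow> H_LF H \<theta> \<beta> \<gamma> p a h U \<alpha> \<le> 0) \<and>
     (\<forall>\<alpha>. node a h \<alpha> \<in> boundary_nodes a b J \<longrightarrow> U \<alpha> \<le> g (node a h \<alpha>)))"

text \<open>Monotonicity in one nodal value: raising that value while the grid function stays in \<open>S\<close>
  changes the operator at \<open>\<alpha>\<close> in the stated direction.\<close>

definition LF_monotone_over where
  "LF_monotone_over H \<theta> \<beta> \<gamma> p a b J S \<longleftrightarrow> (let h = mesh_widths a b J; F = H_LF H \<theta> \<beta> \<gamma> p a h in
     \<forall>\<alpha>. node a h \<alpha> \<in> interior_nodes a b J \<longrightarrow>
       (\<forall>V\<in>S.
         (\<forall>t\<ge>V \<alpha>. V(\<alpha> := t) \<in> S \<longrightarrow> F V \<alpha> \<le> F (V(\<alpha> := t)) \<alpha>) \<and>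
         (\<forall>i. \<forall>\<beta>'\<in>{\<alpha> + axis i 1, \<alpha> - axis i 1}.
            \<forall>t\<ge>V \<beta>'. V(\<beta>' := t) \<in> S \<longrightarrow> F (V(\<beta>' := t)) \<alpha> \<le> F V \<alpha>)))"

definition corrector_solution where
  "corrector_solution H \<theta> \<beta> \<gamma> p g k a b J Ulo Uhi U \<longleftrightarrow> (let h = mesh_widths a b J in
     (\<forall>\<alpha>. node a h \<alpha> \<in> interior_nodes a b J \<longrightarrow> H_corr H \<theta> \<beta> \<gamma> p a h Ulo Uhi U \<alpha> = 0) \<and>
     (\<forall>\<alpha>. node a h \<alpha> \<in> boundary_nodes a b J \<longrightarrow> U \<alpha> - g (node a h \<alpha>) = 0) \<and>
     (\<forall>i \<alpha>. node a h \<alpha> \<in> aux_nodes a b J i \<longrightarrow> aux_op k a b J i U \<alpha> = 0))"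

end

theory Submission
  imports Defs
begin

text \<open>Write \<open>\<alpha>\<close> for an interior node. The corrector is the Lax-Friedrichs operator plus
  \<open>\<gamma> h\<^sup>p / 4\<close> times a sum, with positive weights, of differences between \<open>V\<^sub>\<alpha>\<close> and cutoff values, and
  the cutoff values lie in \<open>[Ulo\<^sub>\<alpha>, Uhi\<^sub>\<alpha>]\<close>. So at a grid function \<open>V\<close> between \<open>Ulo\<close> and \<open>Uhi\<close> with
  \<open>V\<^sub>\<alpha> = Uhi\<^sub>\<alpha>\<close> the added terms are nonnegative, whatever the linear extrapolations are. Monotonicity
  in the neighbours, with the value at \<open>\<alpha>\<close> held fixed, shows that the Lax-Friedrichs operator at \<open>V\<close>
  is at least its value at the supersolution \<open>Uhi\<close>, which is nonnegative. Hence the corrector is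
  nonnegative on the face \<open>V\<^sub>\<alpha> = Uhi\<^sub>\<alpha>\<close> of the box of grid functions between \<open>Ulo\<close> and \<open>Uhi\<close>;
  symmetrically it is nonpositive on the face \<open>V\<^sub>\<alpha> = Ulo\<^sub>\<alpha>\<close>. The corrector itself need not be monotone,
  but a continuous vector field on a box with these signs on opposite faces has a zero: this is the
  theorem of Poincare and Miranda (\<open>poincare_miranda\<close>), a form of Brouwer's fixed point theorem.

  Boundary and ghost values do not become unknowns. The boundary values are given by \<open>g\<close>, which the
  boundary inequalities put between \<open>Ulo\<close> and \<open>Uhi\<close>. The auxiliary boundary condition at a node
  contains a single ghost value, and this ghost value occurs in no other auxiliary condition, so
  solving for it yields an extrapolation from values on the grid (\<open>aux_op_extrapolate\<close>). The
  extrapolation is continuous in the grid values, and it leaves the values on the grid unchanged, so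
  the face inequalities are not affected by it.\<close>

section \<open>The Poincare-Miranda theorem on a finite-dimensional box of functions\<close>

text \<open>The combinatorial half. The dimension \<open>card A\<close> of the box is not tied to a type, so the
  argument starts from Kuhn's labelling lemma, the combinatorial core of Brouwer's theorem, in which
  the number of coordinates is a variable. Labelling the points of a
  lattice of mesh \<open>1 / N\<close> by the signs of the components of \<open>F\<close> gives a lattice cell in which
  every component takes both signs.\<close>

lemma poincare_miranda_approx:
  fixes F :: "('a \<Rightarrow> real) \<Rightarrow> 'a \<Rightarrow> real" and N :: nat
  assumes A: "finite A" and N: "0 < N"
    and le: "lo \<le> hi" and eq: "\<And>\<alpha>. \<alpha> \<notin> A \<Longrightarrow> lo \<alpha> = hi \<alpha>"
    and lower: "\<And>V \<alpha>. V \<in> {lo..hi} \<Longrightarrow> \<alpha> \<in> A \<Longrightarrow> V \<alpha> = lo \<alpha> \<Longrightarrow> F V \<alpha> \<le> 0"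
    and upper: "\<And>V \<alpha>. V \<in> {lo..hi} \<Longrightarrow> \<alpha> \<in> A \<Longrightarrow> V \<alpha> = hi \<alpha> \<Longrightarrow> 0 \<le> F V \<alpha>"
  shows "\<exists>W\<in>{lo..hi}. \<forall>\<alpha>\<in>A. \<exists>u\<in>{lo..hi}. \<exists>v\<in>{lo..hi}.
           (\<forall>\<xi>. \<bar>u \<xi> - W \<xi>\<bar> \<le> (hi \<xi> - lo \<xi>) / N) \<and> (\<forall>\<xi>. \<bar>v \<xi> - W \<xi>\<bar> \<le> (hi \<xi> - lo \<xi>) / N) \<and>
           F u \<alpha> \<le> 0 \<and> 0 \<le> F v \<alpha>"
proof -
  define n where "n = card A"
  obtain e where e: "bij_betw e {..<n} A"
    using ex_bij_betw_nat_finite[OF A] by (auto simp: n_def lessThan_atLeast0)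
  define idx where "idx = inv_into {..<n} e"
  have idx_less: "idx \<alpha> < n" if "\<alpha> \<in> A" for \<alpha>
    using that e unfolding idx_def by (metis bij_betw_def inv_into_into lessThan_iff)
  have e_idx: "e (idx \<alpha>) = \<alpha>" if "\<alpha> \<in> A" for \<alpha>
    using that e unfolding idx_def by (metis bij_betw_inv_into_right)
  have idx_e: "idx (e i) = i" if "i < n" for i
    using that e unfolding idx_def by (metis bij_betw_inv_into_left lessThan_iff)
  have e_in: "e i \<in> A" if "i < n" for i
    using that e by (auto simp: bij_betw_def)
  define pt where "pt x = (\<lambda>\<xi>. lo \<xi> + real (x (idx \<xi>)) / N * (hi \<xi> - lo \<xi>))" for x :: "nat \<Rightarrow> nat"
  have pt_in: "pt x \<in> {lo..hi}" if "\<forall>i<n. x i \<le> N" for x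
  proof -
    have "lo \<xi> \<le> pt x \<xi> \<and> pt x \<xi> \<le> hi \<xi>" for \<xi>
    proof (cases "\<xi> \<in> A")
      case True
      have "lo \<xi> \<le> hi \<xi>" using le by (simp add: le_fun_def)
      moreover have "real (x (idx \<xi>)) / N \<le> 1" using that idx_less[OF True] N by simp
      ultimately have "real (x (idx \<xi>)) / N * (hi \<xi> - lo \<xi>) \<le> 1 * (hi \<xi> - lo \<xi>)"
        by (intro mult_right_mono) auto
      with \<open>lo \<xi> \<le> hi \<xi>\<close> show ?thesis by (auto simp: pt_def)
    qed (simp add: pt_def eq)
    then show ?thesis by (simp add: le_fun_def)
  qed
  \<comment> \<open>Kuhn's lemma prescribes the label 0 on lower faces and 1 on upper faces. The face conditions are
    exactly what makes these forced labels agree with weak signs, also where \<open>lo \<alpha> = hi \<alpha>\<close>.\<close>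
  define label where
    "label x i = (if x i = N \<or> x i \<noteq> 0 \<and> 0 \<le> F (pt x) (e i) then 1 else 0 :: nat)" for x i
  have label_1: "0 \<le> F (pt x) (e i)" if "\<forall>i<n. x i \<le> N" "i < n" "label x i = 1" for x i
  proof (cases "x i = N")
    case True
    then have "pt x (e i) = hi (e i)" using N by (simp add: pt_def idx_e[OF that(2)])
    then show ?thesis using upper pt_in[OF that(1)] e_in[OF that(2)] by blast
  qed (use that in \<open>auto simp: label_def split: if_splits\<close>)
  have label_0: "F (pt x) (e i) \<le> 0" if "\<forall>i<n. x i \<le> N" "i < n" "label x i = 0" for x i
  proof (cases "x i = 0")
    case True
    then have "pt x (e i) = lo (e i)" by (simp add: pt_def idx_e[OF that(2)])
    then show ?thesis using lower pt_in[OF that(1)] e_in[OF that(2)] by blast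
  qed (use that in \<open>auto simp: label_def split: if_splits\<close>)
  obtain q where q: "\<forall>i<n. q i < N"
    and rs: "\<forall>i<n. \<exists>r s. (\<forall>j<n. q j \<le> r j \<and> r j \<le> q j + 1) \<and> (\<forall>j<n. q j \<le> s j \<and> s j \<le> q j + 1)
               \<and> label r i \<noteq> label s i"
  proof (rule kuhn_lemma[OF N, of n label])
    show "\<forall>x. (\<forall>i<n. x i \<le> N) \<longrightarrow> (\<forall>i<n. label x i = 0 \<or> label x i = 1)"
      by (simp add: label_def)
    show "\<forall>x. (\<forall>i<n. x i \<le> N) \<longrightarrow> (\<forall>i<n. x i = 0 \<longrightarrow> label x i = 0)"
      using N by (simp add: label_def)
    show "\<forall>x. (\<forall>i<n. x i \<le> N) \<longrightarrow> (\<forall>i<n. x i = N \<longrightarrow> label x i = 1)"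
      by (simp add: label_def)
  qed (rule that)
  have close: "\<bar>pt x \<xi> - pt q \<xi>\<bar> \<le> (hi \<xi> - lo \<xi>) / N" if "\<forall>j<n. q j \<le> x j \<and> x j \<le> q j + 1" for x \<xi>
  proof (cases "\<xi> \<in> A")
    case True
    have "lo \<xi> \<le> hi \<xi>" using le by (simp add: le_fun_def)
    have "pt x \<xi> - pt q \<xi> = (real (x (idx \<xi>)) - real (q (idx \<xi>))) * ((hi \<xi> - lo \<xi>) / N)"
      by (simp add: pt_def flip: diff_divide_distrib left_diff_distrib)
    moreover have "\<bar>real (x (idx \<xi>)) - real (q (idx \<xi>))\<bar> \<le> 1"
      using that idx_less[OF True] by force
    ultimately show ?thesis using \<open>lo \<xi> \<le> hi \<xi>\<close>
      by (simp add: abs_mult mult_left_le_one_le del: times_divide_eq_right)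
  qed (simp add: pt_def eq)
  have in_range: "\<forall>j<n. x j \<le> N" if "\<forall>j<n. q j \<le> x j \<and> x j \<le> q j + 1" for x
  proof (intro allI impI)
    fix j assume "j < n"
    then have "x j \<le> q j + 1" "q j < N" using that q by blast+
    then show "x j \<le> N" by simp
  qed
  show ?thesis
  proof (rule bexI[of _ "pt q"], rule ballI)
    fix \<alpha> assume \<alpha>: "\<alpha> \<in> A"
    obtain r s where r: "\<forall>j<n. q j \<le> r j \<and> r j \<le> q j + 1" and s: "\<forall>j<n. q j \<le> s j \<and> s j \<le> q j + 1"
      and "label r (idx \<alpha>) \<noteq> label s (idx \<alpha>)"
      using rs[rule_format, OF idx_less[OF \<alpha>]] by blast
    then have "label r (idx \<alpha>) = 0 \<and> label s (idx \<alpha>) = 1 \<or> label r (idx \<alpha>) = 1 \<and> label s (idx \<alpha>) = 0"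
      by (auto simp: label_def split: if_splits)
    then obtain x y where xy: "x \<in> {r, s}" "y \<in> {r, s}" "label x (idx \<alpha>) = 0" "label y (idx \<alpha>) = 1"
      by blast
    then have x: "\<forall>j<n. q j \<le> x j \<and> x j \<le> q j + 1" and y: "\<forall>j<n. q j \<le> y j \<and> y j \<le> q j + 1"
      using r s by auto
    have "F (pt x) \<alpha> \<le> 0"
      using label_0[OF in_range[OF x] idx_less[OF \<alpha>] xy(3)] by (simp add: e_idx[OF \<alpha>])
    moreover have "0 \<le> F (pt y) \<alpha>"
      using label_1[OF in_range[OF y] idx_less[OF \<alpha>] xy(4)] by (simp add: e_idx[OF \<alpha>])
    ultimately show "\<exists>u\<in>{lo..hi}. \<exists>v\<in>{lo..hi}.
           (\<forall>\<xi>. \<bar>u \<xi> - pt q \<xi>\<bar> \<le> (hi \<xi> - lo \<xi>) / N) \<and> (\<forall>\<xi>. \<bar>v \<xi> - pt q \<xi>\<bar> \<le> (hi \<xi> - lo \<xi>) / N) \<and>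
           F u \<alpha> \<le> 0 \<and> 0 \<le> F v \<alpha>"
      using close[OF x] close[OF y] pt_in[OF in_range[OF x]] pt_in[OF in_range[OF y]]
      by - (rule bexI[of _ "pt x"], rule bexI[of _ "pt y"], simp_all)
  next
    show "pt q \<in> {lo..hi}" using q pt_in by (simp add: less_imp_le)
  qed
qed

lemma tendsto_fun_iff:
  fixes f :: "'b \<Rightarrow> 'a \<Rightarrow> 'c::topological_space"
  shows "(f \<longlongrightarrow> l) G \<longleftrightarrow> (\<forall>\<xi>. ((\<lambda>m. f m \<xi>) \<longlongrightarrow> l \<xi>) G)"
  using limitin_componentwise[of "\<lambda>_. euclidean :: 'c topology" UNIV f l G]
  by (simp add: euclidean_product_topology)

lemma compact_fun_interval:
  fixes lo hi :: "'a \<Rightarrow> real"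
  shows "compact {lo..hi}"
proof -
  have "{lo..hi} = PiE UNIV (\<lambda>\<xi>. {lo \<xi>..hi \<xi>})"
    by (auto simp: PiE_UNIV_domain le_fun_def Pi_iff)
  moreover have "compactin (product_topology (\<lambda>_. euclidean) UNIV) (PiE UNIV (\<lambda>\<xi>. {lo \<xi>..hi \<xi>}))"
    by (simp add: compactin_PiE)
  ultimately show ?thesis by (simp add: euclidean_product_topology)
qed

text \<open>As the lattice is refined, the cells subconverge to one point by compactness, and the corners
  at which component \<open>\<alpha>\<close> is nonpositive or nonnegative converge to the same point. The coordinates
  outside \<open>A\<close> are pinned by \<open>lo = hi\<close>, so that a finite-dimensional box is an order interval of
  functions on the whole type. The type is countable to make the product topology first countable, as
  the extraction of subsequences requires.\<close>

theorem poincare_miranda: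
  fixes F :: "('a::countable \<Rightarrow> real) \<Rightarrow> 'a \<Rightarrow> real"
  assumes A: "finite A" and le: "lo \<le> hi" and eq: "\<And>\<alpha>. \<alpha> \<notin> A \<Longrightarrow> lo \<alpha> = hi \<alpha>"
    and cont: "\<And>\<alpha>. \<alpha> \<in> A \<Longrightarrow> continuous_on {lo..hi} (\<lambda>V. F V \<alpha>)"
    and lower: "\<And>V \<alpha>. V \<in> {lo..hi} \<Longrightarrow> \<alpha> \<in> A \<Longrightarrow> V \<alpha> = lo \<alpha> \<Longrightarrow> F V \<alpha> \<le> 0"
    and upper: "\<And>V \<alpha>. V \<in> {lo..hi} \<Longrightarrow> \<alpha> \<in> A \<Longrightarrow> V \<alpha> = hi \<alpha> \<Longrightarrow> 0 \<le> F V \<alpha>"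
  shows "\<exists>V\<in>{lo..hi}. \<forall>\<alpha>\<in>A. F V \<alpha> = 0"
proof -
  define near where "near m W \<alpha> u v \<longleftrightarrow>
      (\<forall>\<xi>. \<bar>u \<xi> - W \<xi>\<bar> \<le> (hi \<xi> - lo \<xi>) / Suc m) \<and> (\<forall>\<xi>. \<bar>v \<xi> - W \<xi>\<bar> \<le> (hi \<xi> - lo \<xi>) / Suc m) \<and>
      F u \<alpha> \<le> 0 \<and> 0 \<le> F v \<alpha>" for m W \<alpha> u v
  have "\<exists>W\<in>{lo..hi}. \<forall>\<alpha>\<in>A. \<exists>u\<in>{lo..hi}. \<exists>v\<in>{lo..hi}. near m W \<alpha> u v" for m
    unfolding near_def by (rule poincare_miranda_approx[OF A _ le eq lower upper]) auto
  then obtain W where W: "\<And>m. W m \<in> {lo..hi}"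
    and "\<And>m. \<forall>\<alpha>\<in>A. \<exists>u\<in>{lo..hi}. \<exists>v\<in>{lo..hi}. near m (W m) \<alpha> u v"
    by metis
  then obtain u v where uv: "\<And>m \<alpha>. \<alpha> \<in> A \<Longrightarrow> u m \<alpha> \<in> {lo..hi} \<and> v m \<alpha> \<in> {lo..hi} \<and>
      near m (W m) \<alpha> (u m \<alpha>) (v m \<alpha>)"
    by metis
  obtain V \<sigma> where V: "V \<in> {lo..hi}" "strict_mono (\<sigma> :: nat \<Rightarrow> nat)" "(W \<circ> \<sigma>) \<longlonglongrightarrow> V"
    using seq_compactE[OF compact_imp_seq_compact[OF compact_fun_interval[of lo hi]]] W by metis
  have lim: "(\<lambda>m. w (\<sigma> m)) \<longlonglongrightarrow> V"
    if w: "\<And>m \<xi>. \<bar>w m \<xi> - W m \<xi>\<bar> \<le> (hi \<xi> - lo \<xi>) / Suc m" for w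
    unfolding tendsto_fun_iff
  proof
    fix \<xi>
    have "(\<lambda>m. (hi \<xi> - lo \<xi>) / Suc m) \<longlonglongrightarrow> 0"
      using LIMSEQ_Suc[OF lim_const_over_n] .
    then have "(\<lambda>m. w m \<xi> - W m \<xi>) \<longlonglongrightarrow> 0"
      by (rule tendsto_rabs_zero_cancel[OF tendsto_sandwich[OF _ _ tendsto_const], rotated 2])
        (use w in auto)
    from LIMSEQ_subseq_LIMSEQ[OF this V(2)]
    have "(\<lambda>m. w (\<sigma> m) \<xi> - W (\<sigma> m) \<xi>) \<longlonglongrightarrow> 0" by (simp add: o_def)
    moreover have "(\<lambda>m. W (\<sigma> m) \<xi>) \<longlonglongrightarrow> V \<xi>"
      using V(3) by (simp add: tendsto_fun_iff)
    ultimately show "(\<lambda>m. w (\<sigma> m) \<xi>) \<longlonglongrightarrow> V \<xi>"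
      using tendsto_add by fastforce
  qed
  have "F V \<alpha> = 0" if \<alpha>: "\<alpha> \<in> A" for \<alpha>
  proof (rule antisym)
    note uv = uv[OF \<alpha>, unfolded near_def]
    have "(\<lambda>m. F (u (\<sigma> m) \<alpha>) \<alpha>) \<longlonglongrightarrow> F V \<alpha>"
      by (rule continuous_on_tendsto_compose[OF cont[OF \<alpha>] lim V(1)]) (use uv in auto)
    then show "F V \<alpha> \<le> 0" by (rule LIMSEQ_le_const2) (use uv in auto)
    have "(\<lambda>m. F (v (\<sigma> m) \<alpha>) \<alpha>) \<longlonglongrightarrow> F V \<alpha>"
      by (rule continuous_on_tendsto_compose[OF cont[OF \<alpha>] lim V(1)]) (use uv in auto)
    then show "0 \<le> F V \<alpha>" by (rule LIMSEQ_le_const) (use uv in auto)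
  qed
  with V(1) show ?thesis by blast
qed

section \<open>Grid nodes and their indices\<close>

definition grid_indices :: "nat ^ 'n \<Rightarrow> (int ^ 'n) set" where
  "grid_indices J = {\<alpha>. \<forall>i. 1 \<le> \<alpha> $ i \<and> \<alpha> $ i \<le> int (J $ i)}"

definition inner_indices :: "nat ^ 'n \<Rightarrow> (int ^ 'n) set" where
  "inner_indices J = {\<alpha>. \<forall>i. 1 < \<alpha> $ i \<and> \<alpha> $ i < int (J $ i)}"

lemma inner_subset_grid_indices: "inner_indices J \<subseteq> grid_indices J"
  by (auto simp: inner_indices_def grid_indices_def less_imp_le)

lemma finite_grid_indices: "finite (grid_indices J)"
proof (rule finite_subset)
  show "grid_indices J \<subseteq> vec_lambda ` PiE UNIV (\<lambda>i. {1..int (J $ i)})"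
  proof
    fix \<alpha> assume "\<alpha> \<in> grid_indices J"
    then have "vec_nth \<alpha> \<in> PiE UNIV (\<lambda>i. {1..int (J $ i)})"
      by (simp add: grid_indices_def PiE_UNIV_domain Pi_iff)
    then show "\<alpha> \<in> vec_lambda ` PiE UNIV (\<lambda>i. {1..int (J $ i)})"
      by (metis image_eqI vec_nth_inverse)
  qed
qed (simp add: finite_PiE)

lemma inner_neighbours_in_grid:
  assumes "\<alpha> \<in> inner_indices J" "\<bar>s\<bar> \<le> 1"
  shows "\<alpha> + axis i s \<in> grid_indices J" "\<alpha> - axis i s \<in> grid_indices J"
  using assms by (auto simp: inner_indices_def grid_indices_def axis_def) (smt (verit))+

lemma node_add_axis:
  "node a h (\<alpha> + axis i 1) = node a h \<alpha> + axis i (h $ i)"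
  "node a h (\<alpha> - axis i 1) = node a h \<alpha> - axis i (h $ i)"
  by (auto simp: node_def vec_eq_iff axis_def algebra_simps)

context
  fixes a b :: "real ^ 'n" and J :: "nat ^ 'n"
  assumes box: "\<And>i. a $ i < b $ i" and nodes: "\<And>i. J $ i \<ge> 2"
begin

lemma mesh_widths_pos: "0 < mesh_widths a b J $ i"
  using box[of i] nodes[of i] by (simp add: mesh_widths_def)

lemma box_nonempty: "box a b \<noteq> {}"
  using box by (simp add: interval_ne_empty_cart)

lemma node_mesh_coord:
  "node a (mesh_widths a b J) \<alpha> $ i = a $ i + (real_of_int (\<alpha> $ i) - 1) * mesh_widths a b J $ i"
  "b $ i = a $ i + (real (J $ i) - 1) * mesh_widths a b J $ i"
  using nodes[of i] by (simp_all add: node_def mesh_widths_def)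

lemma node_coord_bounds:
  "a $ i < node a (mesh_widths a b J) \<alpha> $ i \<longleftrightarrow> 1 < \<alpha> $ i"
  "a $ i \<le> node a (mesh_widths a b J) \<alpha> $ i \<longleftrightarrow> 1 \<le> \<alpha> $ i"
  "node a (mesh_widths a b J) \<alpha> $ i < b $ i \<longleftrightarrow> \<alpha> $ i < int (J $ i)"
  "node a (mesh_widths a b J) \<alpha> $ i \<le> b $ i \<longleftrightarrow> \<alpha> $ i \<le> int (J $ i)"
  unfolding node_mesh_coord using mesh_widths_pos[of i]
  by (auto simp: zero_less_mult_iff zero_le_mult_iff)

lemma node_in_cbox_iff:
  "node a (mesh_widths a b J) \<alpha> \<in> cbox a b \<longleftrightarrow> \<alpha> \<in> grid_indices J"
  by (auto simp: mem_box_cart grid_indices_def node_coord_bounds)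

lemma node_in_grid_iff:
  "node a (mesh_widths a b J) \<alpha> \<in> grid a (mesh_widths a b J) J \<longleftrightarrow> \<alpha> \<in> grid_indices J"
proof
  assume "node a (mesh_widths a b J) \<alpha> \<in> grid a (mesh_widths a b J) J"
  then obtain \<beta> where "\<beta> \<in> grid_indices J" "node a (mesh_widths a b J) \<alpha> = node a (mesh_widths a b J) \<beta>"
    by (auto simp: grid_def grid_indices_def)
  then show "\<alpha> \<in> grid_indices J" by (metis node_in_cbox_iff)
qed (auto simp: grid_def grid_indices_def)

lemma node_interior_iff:
  "node a (mesh_widths a b J) \<alpha> \<in> interior_nodes a b J \<longleftrightarrow> \<alpha> \<in> inner_indices J"
  using inner_subset_grid_indices
  by (auto simp: interior_nodes_def node_in_grid_iff mem_box_cart inner_indices_def node_coord_bounds)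

lemma node_boundary_iff:
  "node a (mesh_widths a b J) \<alpha> \<in> boundary_nodes a b J \<longleftrightarrow> \<alpha> \<in> grid_indices J - inner_indices J"
proof -
  have "frontier (box a b) = cbox a b - box a b" using box_nonempty by (simp add: frontier_box)
  moreover have "node a (mesh_widths a b J) \<alpha> \<in> box a b \<longleftrightarrow> \<alpha> \<in> inner_indices J"
    by (simp add: mem_box_cart inner_indices_def node_coord_bounds)
  ultimately show ?thesis
    by (auto simp: boundary_nodes_def node_in_grid_iff node_in_cbox_iff)
qed

lemma node_in_closure:
  assumes "\<alpha> \<in> grid_indices J"
  shows "node a (mesh_widths a b J) \<alpha> \<in> closure (box a b)"
  using assms box_nonempty by (simp add: closure_box node_in_cbox_iff)

end

section \<open>Ghost values by extrapolation\<close>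

definition nearest_index :: "nat ^ 'n \<Rightarrow> int ^ 'n \<Rightarrow> int ^ 'n" where
  "nearest_index J \<beta> = (\<chi> j. max 1 (min (int (J $ j)) (\<beta> $ j)))"

text \<open>Let \<open>\<beta>\<close> be a ghost index one step outside the grid, \<open>\<alpha>\<close> the boundary index next to it and
  \<open>d = \<alpha> - \<beta>\<close> the step pointing inwards. The value at \<open>\<beta>\<close> is read off at \<open>\<beta>\<close> from the affine function
  through the values at \<open>\<alpha>\<close> and \<open>\<alpha> + d\<close> if the second difference at \<open>\<alpha>\<close> is to vanish, and from the
  quadratic function through the values at \<open>\<alpha>\<close>, \<open>\<alpha> + d\<close> and \<open>\<alpha> + 2d\<close> if it is to equal that at
  \<open>\<alpha> + d\<close>. On the grid \<open>d = 0\<close>, and both formulas collapse to \<open>V \<beta>\<close>.\<close>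

definition extrapolate :: "aux_kind \<Rightarrow> nat ^ 'n \<Rightarrow> 'n grid_fun \<Rightarrow> 'n grid_fun" where
  "extrapolate k J V \<beta> = (let \<alpha> = nearest_index J \<beta>; d = \<alpha> - \<beta> in
     case k of
       Zero_Second_Diff \<Rightarrow> 2 * V \<alpha> - V (\<alpha> + d)
     | Matching_Second_Diff \<Rightarrow> 3 * V \<alpha> - 3 * V (\<alpha> + d) + V (\<alpha> + d + d))"

lemma extrapolate_on_grid:
  assumes "\<alpha> \<in> grid_indices J"
  shows "extrapolate k J V \<alpha> = V \<alpha>"
proof -
  have "nearest_index J \<alpha> = \<alpha>"
    using assms by (simp add: nearest_index_def grid_indices_def vec_eq_iff)
  then show ?thesis by (simp add: extrapolate_def split: aux_kind.split)
qed

lemma continuous_on_extrapolate: "continuous_on S (\<lambda>V. extrapolate k J V \<beta>)"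
  using continuous_on_subset[OF continuous_on_product_coordinates subset_UNIV]
  by (cases k) (auto simp: extrapolate_def Let_def intro!: continuous_intros)

lemma second_diff_axis:
  assumes "\<bar>s\<bar> = 1"
  shows "second_diff h i U \<alpha> = (U (\<alpha> + axis i s) - 2 * U \<alpha> + U (\<alpha> - axis i s)) / (h $ i)\<^sup>2"
proof -
  have "axis i (- 1) = - axis i (1::int)" by (simp add: axis_def vec_eq_iff)
  moreover have "s = 1 \<or> s = - 1" using assms by linarith
  ultimately show ?thesis by (auto simp: second_diff_def)
qed

text \<open>An auxiliary node for direction \<open>i\<close> lies on a face normal to that direction and on no other: its inner neighbour shows that all
  coordinates but the \<open>i\<close>-th are interior. So the ghost index behind it has it as nearest grid index,
  which is why one formula satisfies all the auxiliary conditions at once.\<close>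

lemma aux_op_extrapolate:
  fixes a b :: "real ^ 'n"
  assumes box: "\<And>i. a $ i < b $ i" and nodes: "\<And>i. J $ i \<ge> 2"
    and aux: "node a (mesh_widths a b J) \<alpha> \<in> aux_nodes a b J i"
  shows "aux_op k a b J i (extrapolate k J V) \<alpha> = 0"
proof -
  let ?h = "mesh_widths a b J"
  have \<alpha>: "\<alpha> \<in> grid_indices J" "\<alpha> \<notin> inner_indices J"
    and nbr: "\<alpha> + axis i 1 \<in> inner_indices J \<or> \<alpha> - axis i 1 \<in> inner_indices J"
    using aux by (auto simp: aux_nodes_def Let_def node_boundary_iff[OF box nodes]
        node_interior_iff[OF box nodes] simp flip: node_add_axis)
  \<comment> \<open>The sign \<open>s\<close> orients direction \<open>i\<close> inwards, so that both ends of the grid are treated together.\<close>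
  define s :: int where "s = (if \<alpha> + axis i 1 \<in> inner_indices J then 1 else - 1)"
  have s: "\<bar>s\<bar> = 1" by (simp add: s_def)
  have minus_axis: "axis i (- 1) = - axis i (1::int)" by (simp add: axis_def vec_eq_iff)
  have in_nbr: "inner_neighbour a b J i \<alpha> = \<alpha> + axis i s"
    by (simp add: inner_neighbour_def node_interior_iff[OF box nodes] s_def minus_axis)
  have inner: "\<alpha> + axis i s \<in> inner_indices J"
    using nbr by (auto simp: s_def minus_axis)
  have far: "\<alpha> + axis i s + axis i s \<in> grid_indices J"
    by (rule inner_neighbours_in_grid(1)[OF inner]) (simp add: s)
  have "nearest_index J (\<alpha> - axis i s) = \<alpha>"
    unfolding vec_eq_iff
  proof
    fix j
    show "nearest_index J (\<alpha> - axis i s) $ j = \<alpha> $ j"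
    proof (cases "j = i")
      case False
      then show ?thesis using \<alpha>(1) by (simp add: nearest_index_def grid_indices_def axis_def)
    next
      case True
      have others: "1 < \<alpha> $ j \<and> \<alpha> $ j < int (J $ j)" if "j \<noteq> i" for j
        using inner that by (auto simp: inner_indices_def axis_def dest: spec[of _ j])
      obtain m where m: "\<not> (1 < \<alpha> $ m \<and> \<alpha> $ m < int (J $ m))"
        using \<alpha>(2) by (auto simp: inner_indices_def)
      with others have "m = i" by blast
      with m have "\<not> (1 < \<alpha> $ i \<and> \<alpha> $ i < int (J $ i))" by simp
      moreover have "1 < \<alpha> $ i + s \<and> \<alpha> $ i + s < int (J $ i)"
        using inner by (auto simp: inner_indices_def axis_def dest: spec[of _ i])
      moreover have "1 \<le> \<alpha> $ i \<and> \<alpha> $ i \<le> int (J $ i)" using \<alpha>(1) by (simp add: grid_indices_def)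
      ultimately show ?thesis using s True by (auto simp: nearest_index_def axis_def)
    qed
  qed
  then have ghost: "extrapolate k J V (\<alpha> - axis i s) =
      (case k of Zero_Second_Diff \<Rightarrow> 2 * V \<alpha> - V (\<alpha> + axis i s)
        | Matching_Second_Diff \<Rightarrow> 3 * V \<alpha> - 3 * V (\<alpha> + axis i s) + V (\<alpha> + axis i s + axis i s))"
    by (simp add: extrapolate_def Let_def split: aux_kind.split)
  note on_grid = extrapolate_on_grid[OF \<alpha>(1)] extrapolate_on_grid[OF far]
    extrapolate_on_grid[OF subsetD[OF inner_subset_grid_indices inner]]
  have at_boundary: "second_diff ?h i (extrapolate k J V) \<alpha> =
      (V (\<alpha> + axis i s) - 2 * V \<alpha> + extrapolate k J V (\<alpha> - axis i s)) / (?h $ i)\<^sup>2"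
    by (simp only: second_diff_axis[OF s] on_grid)
  have at_neighbour: "second_diff ?h i (extrapolate k J V) (\<alpha> + axis i s) =
      (V (\<alpha> + axis i s + axis i s) - 2 * V (\<alpha> + axis i s) + V \<alpha>) / (?h $ i)\<^sup>2"
    by (simp only: second_diff_axis[OF s] on_grid add_diff_cancel_right')
  show ?thesis
    unfolding aux_op_def Let_def in_nbr at_boundary at_neighbour ghost
    by (cases k) (simp_all add: add_divide_distrib diff_divide_distrib)
qed

section \<open>The sign of the corrector on the faces of the box\<close>

lemma H_LF_cong:
  assumes "V \<alpha> = W \<alpha>" "\<And>i. V (\<alpha> + axis i 1) = W (\<alpha> + axis i 1)" "\<And>i. V (\<alpha> - axis i 1) = W (\<alpha> - axis i 1)"
  shows "H_LF H \<theta> \<beta> \<gamma> p a h V \<alpha> = H_LF H \<theta> \<beta> \<gamma> p a h W \<alpha>"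
  by (simp add: H_LF_def H_h_def laplace_h_def grad_h_def second_diff_def assms)

text \<open>The monotonicity hypothesis changes one nodal value at a time. Changing the neighbours of \<open>\<alpha>\<close>
  from \<open>V\<close> to \<open>W\<close> one after the other stays in the box, since every intermediate function takes its
  values from \<open>V\<close> or \<open>W\<close>; afterwards it agrees with \<open>W\<close> on the stencil of the operator.\<close>

lemma H_LF_antimono_neighbours:
  fixes a b :: "real ^ 'n"
  assumes mono: "LF_monotone_over H \<theta> \<beta> \<gamma> p a b J (grid_between a b J Ulo Uhi)"
    and \<alpha>: "node a (mesh_widths a b J) \<alpha> \<in> interior_nodes a b J"
    and V: "V \<in> grid_between a b J Ulo Uhi" and W: "W \<in> grid_between a b J Ulo Uhi"
    and centre: "V \<alpha> = W \<alpha>"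
    and le: "\<And>i. V (\<alpha> + axis i 1) \<le> W (\<alpha> + axis i 1)" "\<And>i. V (\<alpha> - axis i 1) \<le> W (\<alpha> - axis i 1)"
  shows "H_LF H \<theta> \<beta> \<gamma> p a (mesh_widths a b J) W \<alpha> \<le> H_LF H \<theta> \<beta> \<gamma> p a (mesh_widths a b J) V \<alpha>"
proof -
  let ?F = "\<lambda>V. H_LF H \<theta> \<beta> \<gamma> p a (mesh_widths a b J) V \<alpha>"
  define N where "N = range (\<lambda>i. \<alpha> + axis i 1) \<union> range (\<lambda>i. \<alpha> - axis i (1::int))"
  define mix where "mix T = (\<lambda>\<xi>. if \<xi> \<in> T then W \<xi> else V \<xi>)" for T
  have mix_in: "mix T \<in> grid_between a b J Ulo Uhi" for T
    using V W by (simp add: grid_between_def mix_def Let_def)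
  have "finite N" by (simp add: N_def)
  then have "?F (mix N) \<le> ?F V"
    using order_refl[of N]
  proof (induction rule: finite_subset_induct')
    case empty
    then show ?case by (simp add: mix_def)
  next
    case (insert \<xi> T)
    have upd: "mix (insert \<xi> T) = (mix T)(\<xi> := W \<xi>)" by (auto simp: mix_def)
    obtain i where i: "\<xi> \<in> {\<alpha> + axis i 1, \<alpha> - axis i 1}" using insert by (auto simp: N_def)
    then have "V \<xi> \<le> W \<xi>" using le by auto
    then have "mix T \<xi> \<le> W \<xi>" by (simp add: mix_def)
    then have "?F (mix (insert \<xi> T)) \<le> ?F (mix T)"
      using mono \<alpha> i mix_in[of T] mix_in[of "insert \<xi> T"]
      unfolding LF_monotone_over_def Let_def upd by blast
    also have "\<dots> \<le> ?F V" by fact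
    finally show ?case .
  qed
  also have "?F (mix N) = ?F W"
    by (rule H_LF_cong) (auto simp: mix_def N_def centre)
  finally show ?thesis .
qed

lemma cutoff_bounds:
  assumes "lo \<le> hi"
  shows "lo \<le> cutoff lo hi v" "cutoff lo hi v \<le> hi"
  using assms by (auto simp: cutoff_def)

lemma cutoff_eq_max_min: "lo \<le> hi \<Longrightarrow> cutoff lo hi v = max lo (min hi v)"
  by (auto simp: cutoff_def)

text \<open>Pairing the reaction term with the two cutoffs makes the sign of the added terms visible.\<close>

lemma H_corr_eq:
  "H_corr H \<theta> \<beta> \<gamma> p a h Ulo Uhi V \<alpha> = H_LF H \<theta> \<beta> \<gamma> p a h V \<alpha> +
     \<gamma> * mesh_size h powr p / 4 * (\<Sum>i\<in>UNIV. 1 / (h $ i)\<^sup>2 *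
       ((V \<alpha> - cutoff (Ulo \<alpha>) (Uhi \<alpha>) (L_plus i V \<alpha>)) + (V \<alpha> - cutoff (Ulo \<alpha>) (Uhi \<alpha>) (L_minus i V \<alpha>))))"
proof -
  have "(\<Sum>i\<in>UNIV. 1 / (h $ i)\<^sup>2 *
       ((V \<alpha> - cutoff (Ulo \<alpha>) (Uhi \<alpha>) (L_plus i V \<alpha>)) + (V \<alpha> - cutoff (Ulo \<alpha>) (Uhi \<alpha>) (L_minus i V \<alpha>))))
    = 2 * (\<Sum>i\<in>UNIV. 1 / (h $ i)\<^sup>2 * V \<alpha>) - (\<Sum>i\<in>UNIV. 1 / (h $ i)\<^sup>2 *
         (cutoff (Ulo \<alpha>) (Uhi \<alpha>) (L_plus i V \<alpha>) + cutoff (Ulo \<alpha>) (Uhi \<alpha>) (L_minus i V \<alpha>)))"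
    unfolding sum_distrib_left sum_subtractf[symmetric]
    by (rule sum.cong) (simp_all add: diff_divide_distrib add_divide_distrib)
  then show ?thesis by (simp add: H_corr_def right_diff_distrib)
qed

lemma H_corr_ge_H_LF:
  assumes "0 \<le> \<gamma>" "Ulo \<alpha> \<le> Uhi \<alpha>" "V \<alpha> = Uhi \<alpha>"
  shows "H_LF H \<theta> \<beta> \<gamma> p a h V \<alpha> \<le> H_corr H \<theta> \<beta> \<gamma> p a h Ulo Uhi V \<alpha>"
proof -
  have s: "0 \<le> (\<Sum>i\<in>UNIV. 1 / (h $ i)\<^sup>2 * ((V \<alpha> - cutoff (Ulo \<alpha>) (Uhi \<alpha>) (L_plus i V \<alpha>)) +
      (V \<alpha> - cutoff (Ulo \<alpha>) (Uhi \<alpha>) (L_minus i V \<alpha>))))"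
    by (intro sum_nonneg mult_nonneg_nonneg add_nonneg_nonneg) (simp_all add: assms cutoff_bounds)
  have c: "0 \<le> \<gamma> * mesh_size h powr p / 4" using assms(1) by simp
  show ?thesis unfolding H_corr_eq using mult_nonneg_nonneg[OF c s] by linarith
qed

lemma H_corr_le_H_LF:
  assumes "0 \<le> \<gamma>" "Ulo \<alpha> \<le> Uhi \<alpha>" "V \<alpha> = Ulo \<alpha>"
  shows "H_corr H \<theta> \<beta> \<gamma> p a h Ulo Uhi V \<alpha> \<le> H_LF H \<theta> \<beta> \<gamma> p a h V \<alpha>"
proof -
  have s: "(\<Sum>i\<in>UNIV. 1 / (h $ i)\<^sup>2 * ((V \<alpha> - cutoff (Ulo \<alpha>) (Uhi \<alpha>) (L_plus i V \<alpha>)) +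
      (V \<alpha> - cutoff (Ulo \<alpha>) (Uhi \<alpha>) (L_minus i V \<alpha>)))) \<le> 0"
    by (intro sum_nonpos mult_nonneg_nonpos add_nonpos_nonpos) (simp_all add: assms cutoff_bounds)
  have c: "0 \<le> \<gamma> * mesh_size h powr p / 4" using assms(1) by simp
  show ?thesis unfolding H_corr_eq using mult_nonneg_nonpos[OF c s] by linarith
qed

section \<open>Continuity of the corrector\<close>

lemma locally_lipschitz_on_imp_continuous_on:
  assumes "locally_lipschitz_on X f"
  shows "continuous_on X f"
  unfolding continuous_on_eq_continuous_within
proof
  fix x assume x: "x \<in> X"
  then obtain r L where r: "r > 0" "L-lipschitz_on (ball x r \<inter> X) f"
    using assms unfolding locally_lipschitz_on_def by blast
  then have "continuous (at x within ball x r \<inter> X) f"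
    using x by (intro lipschitz_on_continuous_within[of L]) auto
  moreover have "at x within ball x r \<inter> X = at x within X"
    using r by (intro at_within_nhd[of _ "ball x r"]) auto
  ultimately show "continuous (at x within X) f" by simp
qed

lemma continuous_on_H_corr:
  assumes H: "continuous_on (UNIV \<times> UNIV \<times> X) (\<lambda>(q, u, x). H q u x)"
    and \<alpha>: "node a h \<alpha> \<in> X" and h: "\<And>i. h $ i \<noteq> 0" and le: "Ulo \<alpha> \<le> Uhi \<alpha>"
    and E: "\<And>\<xi>. continuous_on S (\<lambda>V. E V \<xi>)"
  shows "continuous_on S (\<lambda>V. H_corr H \<theta> \<beta> \<gamma> p a h Ulo Uhi (E V) \<alpha>)"
proof -
  have lap: "continuous_on S (\<lambda>V. laplace_h h (E V) \<alpha>)"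
    unfolding laplace_h_def second_diff_def by (intro continuous_intros E) (use h in simp)
  have "continuous_on S (\<lambda>V. (grad_h h (E V) \<alpha>, E V \<alpha>, node a h \<alpha>))"
    unfolding grad_h_def by (intro continuous_intros continuous_on_vec_lambda E) (use h in simp)
  from continuous_on_compose2[OF H this]
  have "continuous_on S (\<lambda>V. H (grad_h h (E V) \<alpha>) (E V \<alpha>) (node a h \<alpha>))"
    using \<alpha> by auto
  then have "continuous_on S (\<lambda>V. H_LF H \<theta> \<beta> \<gamma> p a h (E V) \<alpha>)"
    unfolding H_LF_def H_h_def by (intro continuous_intros lap E)
  then show ?thesis
    unfolding H_corr_def L_plus_def L_minus_def cutoff_eq_max_min[OF le]
    by (intro continuous_intros E) (use h in simp)
qed

section \<open>Existence for the corrector scheme\<close>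

theorem theorem4p3:
  fixes a b :: "real ^ 'n"
    and J :: "nat ^ 'n"
    and H :: "real ^ 'n \<Rightarrow> real \<Rightarrow> real ^ 'n \<Rightarrow> real"
    and g :: "real ^ 'n \<Rightarrow> real"
    and \<theta> \<beta> \<gamma> p :: real
    and Ulo Uhi :: "'n grid_fun"
    and k :: aux_kind
  assumes "\<And>i. a $ i < b $ i"
    and "\<And>i. J $ i \<ge> 2"
    and "\<theta> > 0"
    and "continuous_on (frontier (box a b)) g"
    and "locally_lipschitz_on (UNIV \<times> UNIV \<times> closure (box a b)) (\<lambda>(q, u, x). H q u x)"
    and "\<And>q x. x \<in> closure (box a b) \<Longrightarrow> mono (\<lambda>u. H q u x)"
    and "\<gamma> > 0" and "\<beta> \<ge> 0" and "0 \<le> p" and "p \<le> 1"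
    and "LF_supersolution H \<theta> \<beta> \<gamma> p g a b J Uhi"
    and "LF_subsolution H \<theta> \<beta> \<gamma> p g a b J Ulo"
    and "\<And>\<alpha>. node a (mesh_widths a b J) \<alpha> \<in> grid a (mesh_widths a b J) J \<Longrightarrow> Ulo \<alpha> \<le> Uhi \<alpha>"
    and "LF_monotone_over H \<theta> \<beta> \<gamma> p a b J (grid_between a b J Ulo Uhi)"
  shows "\<exists>U \<in> grid_between a b J Ulo Uhi. corrector_solution H \<theta> \<beta> \<gamma> p g k a b J Ulo Uhi U"
proof -
  let ?h = "mesh_widths a b J" and ?G = "grid_indices J" and ?I = "inner_indices J"
  note box = assms(1) and nodes = assms(2) and mono = assms(14)
  note idx = node_in_grid_iff[OF box nodes] node_interior_iff[OF box nodes]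
    node_boundary_iff[OF box nodes]
  have \<gamma>: "0 \<le> \<gamma>" using assms(7) by simp
  have IG: "\<alpha> \<in> ?G" if "\<alpha> \<in> ?I" for \<alpha> using that inner_subset_grid_indices by blast
  have nbr: "\<alpha> + axis i 1 \<in> ?G" "\<alpha> - axis i 1 \<in> ?G" if "\<alpha> \<in> ?I" for \<alpha> i
    using inner_neighbours_in_grid[OF that] by simp_all
  have le: "Ulo \<alpha> \<le> Uhi \<alpha>" if "\<alpha> \<in> ?G" for \<alpha>
    using assms(13) that by (simp add: idx)
  have super: "0 \<le> H_LF H \<theta> \<beta> \<gamma> p a ?h Uhi \<alpha>" and sub: "H_LF H \<theta> \<beta> \<gamma> p a ?h Ulo \<alpha> \<le> 0"
    if "\<alpha> \<in> ?I" for \<alpha>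
    using assms(11,12) that by (auto simp: LF_supersolution_def LF_subsolution_def idx Let_def)
  have g_between: "Ulo \<alpha> \<le> g (node a ?h \<alpha>)" "g (node a ?h \<alpha>) \<le> Uhi \<alpha>" if "\<alpha> \<in> ?G" "\<alpha> \<notin> ?I" for \<alpha>
    using assms(11,12) that by (auto simp: LF_supersolution_def LF_subsolution_def idx Let_def)
  \<comment> \<open>The box has \<open>ext Ulo\<close> and \<open>ext Uhi\<close> as corners: only interior values are free. Boundary values
    are pinned to \<open>g\<close>, and the 0 outside the grid is a placeholder, the ghost values being supplied
    by \<open>E\<close>.\<close>
  define ext where "ext U = (\<lambda>\<alpha>. if \<alpha> \<in> ?I then U \<alpha> else if \<alpha> \<in> ?G then g (node a ?h \<alpha>) else 0)"
    for U :: "'n grid_fun"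
  define E where "E = extrapolate k J"
  define F where "F V = H_corr H \<theta> \<beta> \<gamma> p a ?h Ulo Uhi (E V)" for V
  have E_grid: "E V \<alpha> = V \<alpha>" if "\<alpha> \<in> ?G" for V \<alpha>
    using that by (simp add: E_def extrapolate_on_grid)
  have between: "Ulo \<alpha> \<le> E V \<alpha> \<and> E V \<alpha> \<le> Uhi \<alpha>" if "V \<in> {ext Ulo..ext Uhi}" "\<alpha> \<in> ?G" for V \<alpha>
  proof -
    have "ext Ulo \<alpha> \<le> V \<alpha>" "V \<alpha> \<le> ext Uhi \<alpha>" using that(1) by (auto simp: le_fun_def)
    then show ?thesis using g_between[OF that(2)] that(2)
      by (auto simp: ext_def E_grid split: if_splits)
  qed
  have in_S: "E V \<in> grid_between a b J Ulo Uhi" if "V \<in> {ext Ulo..ext Uhi}" for V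
    using between[OF that] by (simp add: grid_between_def Let_def idx)
  have U_in_S: "Ulo \<in> grid_between a b J Ulo Uhi" "Uhi \<in> grid_between a b J Ulo Uhi"
    using le by (auto simp: grid_between_def Let_def idx)
  have "\<exists>V\<in>{ext Ulo..ext Uhi}. \<forall>\<alpha>\<in>?I. F V \<alpha> = 0"
  proof (rule poincare_miranda)
    show "finite ?I"
      using finite_grid_indices inner_subset_grid_indices by (rule finite_subset[rotated])
    show "ext Ulo \<le> ext Uhi" using le IG by (simp add: le_fun_def ext_def)
    show "ext Ulo \<alpha> = ext Uhi \<alpha>" if "\<alpha> \<notin> ?I" for \<alpha> using that by (simp add: ext_def)
    show "continuous_on {ext Ulo..ext Uhi} (\<lambda>V. F V \<alpha>)" if "\<alpha> \<in> ?I" for \<alpha>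
      unfolding F_def E_def
    proof (rule continuous_on_H_corr[OF locally_lipschitz_on_imp_continuous_on[OF assms(5)]])
      show "node a ?h \<alpha> \<in> closure (box a b)"
        using node_in_closure[OF box nodes] IG[OF that] by blast
      show "?h $ i \<noteq> 0" for i using mesh_widths_pos[OF box nodes, of i] by simp
    qed (use le IG[OF that] continuous_on_extrapolate in blast)+
  next
    fix V \<alpha> assume V: "V \<in> {ext Ulo..ext Uhi}" and \<alpha>: "\<alpha> \<in> ?I" and "V \<alpha> = ext Ulo \<alpha>"
    then have centre: "E V \<alpha> = Ulo \<alpha>" using E_grid[OF IG] by (simp add: ext_def)
    have "F V \<alpha> \<le> H_LF H \<theta> \<beta> \<gamma> p a ?h (E V) \<alpha>"
      unfolding F_def by (rule H_corr_le_H_LF) (use \<gamma> le[OF IG[OF \<alpha>]] centre in auto)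
    also have "\<dots> \<le> H_LF H \<theta> \<beta> \<gamma> p a ?h Ulo \<alpha>"
      using between[OF V] nbr[OF \<alpha>] centre \<alpha>
      by (intro H_LF_antimono_neighbours[OF mono _ U_in_S(1) in_S[OF V]]) (auto simp: idx)
    also have "\<dots> \<le> 0" by (rule sub[OF \<alpha>])
    finally show "F V \<alpha> \<le> 0" .
  next
    fix V \<alpha> assume V: "V \<in> {ext Ulo..ext Uhi}" and \<alpha>: "\<alpha> \<in> ?I" and "V \<alpha> = ext Uhi \<alpha>"
    then have centre: "E V \<alpha> = Uhi \<alpha>" using E_grid[OF IG] by (simp add: ext_def)
    have "0 \<le> H_LF H \<theta> \<beta> \<gamma> p a ?h Uhi \<alpha>" by (rule super[OF \<alpha>])
    also have "\<dots> \<le> H_LF H \<theta> \<beta> \<gamma> p a ?h (E V) \<alpha>"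
      using between[OF V] nbr[OF \<alpha>] centre \<alpha>
      by (intro H_LF_antimono_neighbours[OF mono _ in_S[OF V] U_in_S(2)]) (auto simp: idx)
    also have "\<dots> \<le> F V \<alpha>"
      unfolding F_def by (rule H_corr_ge_H_LF) (use \<gamma> le[OF IG[OF \<alpha>]] centre in auto)
    finally show "0 \<le> F V \<alpha>" .
  qed
  then obtain V where V: "V \<in> {ext Ulo..ext Uhi}" and zero: "\<And>\<alpha>. \<alpha> \<in> ?I \<Longrightarrow> F V \<alpha> = 0"
    by blast
  have boundary: "E V \<alpha> = g (node a ?h \<alpha>)" if "\<alpha> \<in> ?G" "\<alpha> \<notin> ?I" for \<alpha>
  proof -
    have "ext Ulo \<alpha> \<le> V \<alpha>" "V \<alpha> \<le> ext Uhi \<alpha>" using V by (auto simp: le_fun_def)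
    then show ?thesis using that by (simp add: ext_def E_grid)
  qed
  have "corrector_solution H \<theta> \<beta> \<gamma> p g k a b J Ulo Uhi (E V)"
    unfolding corrector_solution_def Let_def
    using zero boundary aux_op_extrapolate[OF box nodes, of _ _ k V]
    by (auto simp: idx F_def E_def)
  with in_S[OF V] show ?thesis by blast
qed

end
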